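(* Let $\mathrm{H}$ be an endo-trivial reflexive digraph with at least three vertices. Then every polymorphism of $\mathrm{H}$ is essentially unary.
   Context: All digraphs are finite and may have loops; a digraph is reflexive if every vertex has a loop. An endomorphism of $\mathrm{H}$ is a homomorphism from $\mathrm{H}$ to itself (a map $f:V(\mathrm{H})\to V(\mathrm{H})$ with $(f(u),f(v))\in E(\mathrm{H})$ whenever $(u,v)\in E(\mathrm{H})$). An automorphism is a bijective endomorphism whose inverse is a homomorphism. A constant map sends all vertices to a single vertex. $\mathrm{H}$ is endo-trivial if every endomorphism of $\mathrm{H}$ is an automorphism or a constant map. A $k$-ary polymorphism ($k\ge 1$) of $\mathrm{H}$ is a map $f:V(\mathrm{H})^k\to V(\mathrm{H})$ such that whenever $(x_1,y_1),\dots,(x_k,y_k)\in E(\mathrm{H})$ we have $(f(x_1,\dots,x_k),f(y_1,\dots,y_k))\in E(\mathrm{H})$. A $k$-ary operation $f$ is essentially unary if there exist a unary operation $g$ and $i\in\{1,\dots,k\}$ with $f(x_1,\dots,x_k)=g(x_i)$ for all $(x_1,\dots,x_k)$. *)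

theory Defs
  imports "Graph_Theory.Pair_Digraph" "HOL-Library.FuncSet"
begin

definition digraph_hom :: "'a pair_pre_digraph \<Rightarrow> 'b pair_pre_digraph \<Rightarrow> ('a \<Rightarrow> 'b) set" where
  "digraph_hom G H =
    {f \<in> pverts G \<rightarrow> pverts H. \<forall>(u, v) \<in> parcs G. (f u, f v) \<in> parcs H}"

definition reflexive_digraph :: "'a pair_pre_digraph \<Rightarrow> bool" where
  "reflexive_digraph H \<longleftrightarrow> refl_on (pverts H) (parcs H)"

text \<open>
  Maps on the vertex set are total HOL functions whose values outside the vertex set are
  irrelevant; no predicate below depends on them.
\<close>

definition endomorphism :: "'a pair_pre_digraph \<Rightarrow> ('a \<Rightarrow> 'a) \<Rightarrow> bool" where
  "endomorphism H f \<longleftrightarrow> f \<in> digraph_hom H H"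

definition automorphism :: "'a pair_pre_digraph \<Rightarrow> ('a \<Rightarrow> 'a) \<Rightarrow> bool" where
  "automorphism H f \<longleftrightarrow>
    endomorphism H f \<and> bij_betw f (pverts H) (pverts H) \<and>
    the_inv_into (pverts H) f \<in> digraph_hom H H"

definition constant_map :: "'a pair_pre_digraph \<Rightarrow> ('a \<Rightarrow> 'a) \<Rightarrow> bool" where
  "constant_map H f \<longleftrightarrow> (\<exists>c \<in> pverts H. \<forall>x \<in> pverts H. f x = c)"

definition endo_trivial :: "'a pair_pre_digraph \<Rightarrow> bool" where
  "endo_trivial H \<longleftrightarrow> (\<forall>f. endomorphism H f \<longrightarrow> automorphism H f \<or> constant_map H f)"

text \<open>
  A \<open>k\<close>-tuple over \<open>A\<close> is an extensional function on the index set \<open>{..<k}\<close>, so that tuples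
  with equal components are equal; coordinates are numbered from 0.
\<close>

abbreviation tuples :: "nat \<Rightarrow> 'a set \<Rightarrow> (nat \<Rightarrow> 'a) set" where
  "tuples k A \<equiv> {..<k} \<rightarrow>\<^sub>E A"

definition polymorphism :: "'a pair_pre_digraph \<Rightarrow> nat \<Rightarrow> ((nat \<Rightarrow> 'a) \<Rightarrow> 'a) \<Rightarrow> bool" where
  "polymorphism H k f \<longleftrightarrow>
    f \<in> tuples k (pverts H) \<rightarrow> pverts H \<and>
    (\<forall>x \<in> tuples k (pverts H). \<forall>y \<in> tuples k (pverts H).
      (\<forall>i<k. (x i, y i) \<in> parcs H) \<longrightarrow> (f x, f y) \<in> parcs H)"

definition essentially_unary :: "'a set \<Rightarrow> nat \<Rightarrow> ((nat \<Rightarrow> 'a) \<Rightarrow> 'a) \<Rightarrow> bool" where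
  "essentially_unary A k f \<longleftrightarrow> (\<exists>g \<in> A \<rightarrow> A. \<exists>i<k. \<forall>x \<in> tuples k A. f x = g (x i))"

end

theory Submission
  imports Defs
begin

text \<open>
  Regard the endomorphisms of \<open>H\<close> as a digraph: \<open>f \<rightarrow> g\<close> if \<open>f u \<rightarrow> g v\<close> whenever
  \<open>u \<rightarrow> v\<close>. Endo-triviality forbids any endomorphism with exactly two values, so \<open>H\<close> is weakly
  connected, antisymmetric, and has no vertex dominating, or dominated by, all others. It follows
  that an automorphism is adjacent only to itself. Fixing all but one argument of a polymorphism
  gives an endomorphism, and moving one of the fixed arguments along an edge gives an adjacent one.
  Hence, if one of these endomorphisms is an automorphism, it does not depend on the fixed
  arguments; otherwise all of them are constant, and so is the polymorphism.
\<close>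

text \<open>Pass from \<open>x\<close> to \<open>y\<close> one coordinate at a time:
  \<open>?z n\<close> already agrees with \<open>y\<close> below \<open>n\<close> and still with
  \<open>x\<close> from \<open>n\<close> on.\<close>

lemma tuple_function_const:
  assumes step: "\<And>x j a. x \<in> tuples k A \<Longrightarrow> j < k \<Longrightarrow> a \<in> A \<Longrightarrow> F (x(j := a)) = F x"
    and x: "x \<in> tuples k A" and y: "y \<in> tuples k A"
  shows "F x = F y"
proof -
  let ?z = "\<lambda>n j. if j < n then y j else x j"
  have "?z n \<in> tuples k A \<and> F (?z n) = F x" if "n \<le> k" for n
    using that
  proof (induction n)
    case 0
    then show ?case using x by simp
  next
    case (Suc n)
    have yn: "y n \<in> A" using y Suc.prems by (auto simp: PiE_iff)
    have *: "?z (Suc n) = (?z n)(n := y n)" by (auto simp: less_Suc_eq)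
    have "(?z n)(n := y n) \<in> tuples k A"
      using Suc yn by (auto simp: PiE_iff extensional_def)
    moreover have "F ((?z n)(n := y n)) = F x"
      using step[of "?z n" n "y n"] Suc yn by auto
    ultimately show ?case unfolding * by simp
  qed
  moreover have "?z k = y"
    using x y by (auto simp: PiE_iff extensional_def)
  ultimately show ?thesis by force
qed

lemma endomorphism_iff:
  "endomorphism H f \<longleftrightarrow>
    (\<forall>u \<in> pverts H. f u \<in> pverts H) \<and> (\<forall>u v. (u, v) \<in> parcs H \<longrightarrow> (f u, f v) \<in> parcs H)"
  by (auto simp: endomorphism_def digraph_hom_def)

locale endo_trivial_reflexive_digraph = pair_fin_digraph H for H :: "'a pair_pre_digraph" +
  assumes reflexive: "reflexive_digraph H"
    and trivial: "endo_trivial H"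
    and card_verts: "card (pverts H) \<ge> 3"
begin

lemma loop: "u \<in> pverts H \<Longrightarrow> (u, u) \<in> parcs H"
  using reflexive by (auto simp: reflexive_digraph_def refl_on_def)

lemma arc_verts: "(u, v) \<in> parcs H \<Longrightarrow> u \<in> pverts H \<and> v \<in> pverts H"
  using in_arcsD1 in_arcsD2 by blast

text \<open>Two values cannot separate three vertices, so \<open>h\<close> is not injective, hence
  no automorphism. Connectivity, antisymmetry and the absence of universal sinks and sources are all
  obtained by exhibiting a suitable \<open>h\<close>.\<close>

lemma two_valued_endomorphism_const:
  assumes h: "endomorphism H h" and ab: "h ` pverts H \<subseteq> {a, b}"
    and u: "u \<in> pverts H" and v: "v \<in> pverts H"
  shows "h u = h v"
proof -
  have "\<not> inj_on h (pverts H)"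
  proof
    assume "inj_on h (pverts H)"
    then have "card (pverts H) \<le> card {a, b}"
      using ab by (metis card_image card_mono finite.emptyI finite.insertI)
    then show False using card_verts card_insert_le_m1[of 2 "{b}" a] by simp
  qed
  then have "constant_map H h"
    using trivial h by (auto simp: endo_trivial_def automorphism_def bij_betw_def)
  then show ?thesis using u v by (auto simp: constant_map_def)
qed

text \<open>This is weak connectivity. No arc joins the level set of \<open>G u\<close> to its
  complement, so sending the former to \<open>u\<close> and the latter to \<open>v\<close> uses only
  the loops at \<open>u\<close> and \<open>v\<close>.\<close>

lemma arc_invariant_const:
  assumes inv: "\<And>u v. (u, v) \<in> parcs H \<Longrightarrow> G u = G v"
    and u: "u \<in> pverts H" and v: "v \<in> pverts H"
  shows "G u = G v"
proof (rule ccontr)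
  assume ne: "G u \<noteq> G v"
  let ?h = "\<lambda>w. if G w = G u then u else v"
  have "endomorphism H ?h"
    using loop[OF u] loop[OF v] u v by (auto simp: endomorphism_iff dest: inv)
  from two_valued_endomorphism_const[OF this _ u v, of u v] ne show False by auto
qed

text \<open>With arcs both ways and both loops, every map into \<open>{a, b}\<close> is an
  endomorphism, in particular the one that singles out \<open>a\<close>.\<close>

lemma antisym:
  assumes "(a, b) \<in> parcs H" "(b, a) \<in> parcs H"
  shows "a = b"
proof -
  have ab: "a \<in> pverts H" "b \<in> pverts H" using assms arc_verts by auto
  have "endomorphism H (\<lambda>w. if w = a then a else b)"
    using assms ab loop[OF ab(1)] loop[OF ab(2)] by (auto simp: endomorphism_iff)
  from two_valued_endomorphism_const[OF this _ ab, of a b] show ?thesis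
    by (auto split: if_splits)
qed

lemma other_vertex: "\<exists>x \<in> pverts H. x \<noteq> c"
proof (rule ccontr)
  assume "\<not> ?thesis"
  then have "card (pverts H) \<le> card {c}" by (intro card_mono) auto
  then show False using card_verts by simp
qed

text \<open>By antisymmetry only the loop leaves \<open>c\<close>, so all other vertices can be
  collapsed to a single \<open>x \<noteq> c\<close>: the arcs needed in the image are the two loops
  and \<open>(x, c)\<close>.\<close>

lemma no_universal_sink:
  assumes c: "c \<in> pverts H" and sink: "\<And>u. u \<in> pverts H \<Longrightarrow> (u, c) \<in> parcs H"
  shows False
proof -
  obtain x where x: "x \<in> pverts H" "x \<noteq> c" using other_vertex by blast
  have "w = c" if "(c, w) \<in> parcs H" for w
    using that antisym sink arc_verts by blast
  then have "endomorphism H (\<lambda>w. if w = c then c else x)"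
    using c x(1) loop[OF c] loop[OF x(1)] sink[OF x(1)] by (auto simp: endomorphism_iff)
  from two_valued_endomorphism_const[OF this _ c x(1), of c x] x(2) show False by auto
qed

lemma no_universal_source:
  assumes c: "c \<in> pverts H" and source: "\<And>u. u \<in> pverts H \<Longrightarrow> (c, u) \<in> parcs H"
  shows False
proof -
  obtain x where x: "x \<in> pverts H" "x \<noteq> c" using other_vertex by blast
  have "w = c" if "(w, c) \<in> parcs H" for w
    using that antisym source arc_verts by blast
  then have "endomorphism H (\<lambda>w. if w = c then c else x)"
    using c x(1) loop[OF c] loop[OF x(1)] source[OF x(1)] by (auto simp: endomorphism_iff)
  from two_valued_endomorphism_const[OF this _ c x(1), of c x] x(2) show False by auto
qed

text \<open>The map \<open>(u, v) \<mapsto> (s u, g v)\<close> is injective on the finite set of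
  arcs, so it permutes them and some arc \<open>(p, w)\<close> is sent to the loop at
  \<open>s u\<close>. Then \<open>p = u\<close>, and \<open>s w\<close> has arcs to and from
  \<open>s u\<close>, the one to it because the loop at \<open>w\<close> gives
  \<open>(s w, g w)\<close>. Antisymmetry forces \<open>w = u\<close>.\<close>

lemma adjacent_injective_endomorphisms_eq:
  assumes s: "endomorphism H s" "inj_on s (pverts H)"
    and g: "inj_on g (pverts H)"
    and adj: "\<And>u v. (u, v) \<in> parcs H \<Longrightarrow> (s u, g v) \<in> parcs H"
    and u: "u \<in> pverts H"
  shows "g u = s u"
proof -
  have "inj_on (map_prod s g) (parcs H)"
    using map_prod_inj_on[OF s(2) g] by (rule inj_on_subset) (auto dest: arc_verts)
  moreover have "map_prod s g ` parcs H \<subseteq> parcs H" using adj by auto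
  ultimately have "map_prod s g ` parcs H = parcs H"
    by (intro endo_inj_surj) auto
  moreover have "(s u, s u) \<in> parcs H" using s(1) loop[OF u] by (auto simp: endomorphism_iff)
  ultimately have "(s u, s u) \<in> map_prod s g ` parcs H" by simp
  then obtain p w where pw: "(p, w) \<in> parcs H" "s p = s u" "g w = s u" by auto
  then have "p = u" using s(2) u arc_verts by (metis inj_onD)
  then have "(s u, s w) \<in> parcs H" "(s w, s u) \<in> parcs H"
    using pw s(1) adj[of w w] loop[of w] arc_verts[of p w] by (auto simp: endomorphism_iff)
  then have "s w = s u" using antisym by blast
  then have "w = u" using s(2) u pw(1) arc_verts by (metis inj_onD)
  then show ?thesis using pw(3) by simp
qed

text \<open>Since \<open>s\<close> is surjective, the value of a constant \<open>g\<close> would be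
  a universal sink or source. So \<open>g\<close> is an automorphism, and the previous lemma
  applies, with \<open>s\<close> and \<open>g\<close> exchanged if the adjacency runs from
  \<open>g\<close> to \<open>s\<close>.\<close>

lemma adjacent_to_automorphism_eq:
  assumes s: "automorphism H s" and g: "endomorphism H g"
    and adj: "(\<forall>u v. (u, v) \<in> parcs H \<longrightarrow> (s u, g v) \<in> parcs H) \<or>
      (\<forall>u v. (u, v) \<in> parcs H \<longrightarrow> (g u, s v) \<in> parcs H)"
    and u: "u \<in> pverts H"
  shows "g u = s u"
proof -
  have s': "endomorphism H s" "inj_on s (pverts H)" "s ` pverts H = pverts H"
    using s by (auto simp: automorphism_def bij_betw_def)
  have "\<not> constant_map H g"
  proof
    assume "constant_map H g"
    then obtain c where c: "c \<in> pverts H" "\<And>x. x \<in> pverts H \<Longrightarrow> g x = c"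
      by (auto simp: constant_map_def)
    from adj have "(\<forall>v \<in> pverts H. (s v, c) \<in> parcs H) \<or> (\<forall>v \<in> pverts H. (c, s v) \<in> parcs H)"
      using c(2) loop by metis
    then have "(\<forall>v \<in> pverts H. (v, c) \<in> parcs H) \<or> (\<forall>v \<in> pverts H. (c, v) \<in> parcs H)"
      using s'(3) by (metis imageE)
    then show False using no_universal_sink[OF c(1)] no_universal_source[OF c(1)] by blast
  qed
  then have "inj_on g (pverts H)"
    using trivial g by (auto simp: endo_trivial_def automorphism_def bij_betw_def)
  then show ?thesis
    using adj adjacent_injective_endomorphisms_eq[OF s'(1,2) _ _ u, of g]
      adjacent_injective_endomorphisms_eq[OF g _ s'(2) _ u] by force
qed

lemma polymorphism_essentially_unary:
  assumes k: "k \<ge> 1" and f: "polymorphism H k f"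
  shows "essentially_unary (pverts H) k f"
proof -
  let ?V = "pverts H"
  have upd: "x(i := y) \<in> tuples k ?V" if "x \<in> tuples k ?V" "i < k" "y \<in> ?V" for x i y
    using that by (auto simp: PiE_iff extensional_def)
  have loops: "\<forall>j<k. (x j, x j) \<in> parcs H" if "x \<in> tuples k ?V" for x
    using that loop by auto
  \<comment> \<open>For \<open>x = y\<close> this makes the slice at \<open>x\<close> an
    endomorphism, the loops serving the fixed coordinates. For \<open>x\<close> and \<open>y\<close>
    joined by arcs in every coordinate it makes their slices adjacent.\<close>
  have f_arc: "(f (x(i := u)), f (y(i := v))) \<in> parcs H"
    if "x \<in> tuples k ?V" "y \<in> tuples k ?V" "i < k" "(u, v) \<in> parcs H"
      and "\<forall>j<k. (x j, y j) \<in> parcs H" for x y i u v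
  proof -
    have "x(i := u) \<in> tuples k ?V" "y(i := v) \<in> tuples k ?V"
      using that(3) arc_verts[OF that(4)] upd[OF that(1)] upd[OF that(2)] by simp_all
    moreover have "\<forall>j<k. ((x(i := u)) j, (y(i := v)) j) \<in> parcs H"
      using that(4,5) by simp
    ultimately show ?thesis using f unfolding polymorphism_def by blast
  qed
  have f_vert: "f x \<in> ?V" if "x \<in> tuples k ?V" for x
    using f that unfolding polymorphism_def by blast
  have slice: "endomorphism H (\<lambda>y. f (x(i := y)))" if "x \<in> tuples k ?V" "i < k" for x i
    unfolding endomorphism_iff
    using f_vert[OF upd[OF that]] f_arc[OF that(1) that(1) that(2)] loops[OF that(1)] by blast
  show ?thesis
  proof (cases "\<exists>x \<in> tuples k ?V. \<exists>i<k. automorphism H (\<lambda>y. f (x(i := y)))")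
    case True
    then obtain x i where x: "x \<in> tuples k ?V" and i: "i < k"
      and aut: "automorphism H (\<lambda>y. f (x(i := y)))" by blast
    let ?s = "\<lambda>y. f (x(i := y))"
    \<comment> \<open>\<open>?P z\<close> says that the slice at \<open>z\<close> is the same
      automorphism as the slice at \<open>x\<close>; the aim is to spread this from \<open>x\<close>
      to all tuples.\<close>
    let ?P = "\<lambda>z. \<forall>y \<in> ?V. f (z(i := y)) = ?s y"
    have arc: "?P (z(j := a)) = ?P (z(j := b))"
      if z: "z \<in> tuples k ?V" and j: "j < k" "j \<noteq> i" and ab: "(a, b) \<in> parcs H" for z j a b
    proof -
      have V: "a \<in> ?V" "b \<in> ?V" using ab arc_verts by auto
      have adj: "(f (z(j := a, i := u)), f (z(j := b, i := v))) \<in> parcs H"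
        if "(u, v) \<in> parcs H" for u v
        by (rule f_arc[OF upd[OF z j(1) V(1)] upd[OF z j(1) V(2)] i that])
          (simp add: ab loops[OF z])
      note sl = slice[OF upd[OF z j(1) V(1)] i] slice[OF upd[OF z j(1) V(2)] i]
      show ?thesis
      proof
        assume "?P (z(j := a))"
        then have "\<forall>u v. (u, v) \<in> parcs H \<longrightarrow> (?s u, f (z(j := b, i := v))) \<in> parcs H"
          using adj arc_verts by metis
        then show "?P (z(j := b))" using adjacent_to_automorphism_eq[OF aut sl(2)] by blast
      next
        assume "?P (z(j := b))"
        then have "\<forall>u v. (u, v) \<in> parcs H \<longrightarrow> (f (z(j := a, i := u)), ?s v) \<in> parcs H"
          using adj arc_verts by metis
        then show "?P (z(j := a))" using adjacent_to_automorphism_eq[OF aut sl(1)] by blast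
      qed
    qed
    have step: "?P (z(j := a)) = ?P z" if z: "z \<in> tuples k ?V" and j: "j < k" and a: "a \<in> ?V" for z j a
    \<comment> \<open>For \<open>j = i\<close> the new entry is overwritten in \<open>?P\<close>.
      Otherwise the truth value of \<open>?P\<close> is invariant along arcs in coordinate
      \<open>j\<close>, hence constant by weak connectivity.\<close>
    proof (cases "j = i")
      case False
      have "z j \<in> ?V" using z j by auto
      from arc_invariant_const[of "\<lambda>a. ?P (z(j := a))", OF arc[OF z j False] a this]
      show ?thesis by simp
    qed simp
    have P: "?P z" if "z \<in> tuples k ?V" for z
    proof -
      have "?P z = ?P x"
        by (rule tuple_function_const[of k ?V ?P z x, OF _ that x]) (rule step)
      then show ?thesis by simp
    qed
    have "f z = ?s (z i)" if "z \<in> tuples k ?V" for z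
    proof -
      have "z i \<in> ?V" using that i by auto
      then have "f (z(i := z i)) = ?s (z i)" using P[OF that] by blast
      then show ?thesis by simp
    qed
    moreover have "?s \<in> ?V \<rightarrow> ?V" using f_vert[OF upd[OF x i]] by (rule Pi_I)
    ultimately show ?thesis
      unfolding essentially_unary_def using i by (intro bexI[of _ ?s] exI[of _ i]) simp_all
  next
    case False
    have const: "f (x(j := a)) = f x" if x: "x \<in> tuples k ?V" and j: "j < k" and a: "a \<in> ?V" for x j a
    proof -
      \<comment> \<open>No slice is an automorphism in this case, so endo-triviality leaves only
        constants.\<close>
      have "constant_map H (\<lambda>y. f (x(j := y)))"
        using trivial slice[OF x j] False x j by (auto simp: endo_trivial_def)
      moreover have "x j \<in> ?V" using x j by auto
      ultimately have "f (x(j := a)) = f (x(j := x j))" using a unfolding constant_map_def by metis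
      then show ?thesis by simp
    qed
    obtain v where v: "v \<in> ?V" using other_vertex by blast
    define t where "t = (\<lambda>i\<in>{..<k}. v)"
    have t: "t \<in> tuples k ?V" using v by (auto simp: t_def)
    have "f x = f t" if "x \<in> tuples k ?V" for x
      by (rule tuple_function_const[of k ?V f, OF _ that t]) (rule const)
    moreover have "(\<lambda>_. f t) \<in> ?V \<rightarrow> ?V" using f_vert[OF t] by (rule Pi_I)
    \<comment> \<open>As \<open>f\<close> is constant, any coordinate would do; \<open>0\<close> is
      one because \<open>k \<ge> 1\<close>.\<close>
    ultimately show ?thesis
      unfolding essentially_unary_def using k by (intro bexI[of _ "\<lambda>_. f t"] exI[of _ 0]) simp_all
  qed
qed

end

theorem theorem9:
  fixes H :: "'a pair_pre_digraph" and k :: nat and f :: "(nat \<Rightarrow> 'a) \<Rightarrow> 'a"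
  assumes "pair_fin_digraph H"
    and "reflexive_digraph H"
    and "endo_trivial H"
    and "card (pverts H) \<ge> 3"
    and "k \<ge> 1"
    and "polymorphism H k f"
  shows "essentially_unary (pverts H) k f"
proof -
  interpret endo_trivial_reflexive_digraph H
    using assms by (simp add: endo_trivial_reflexive_digraph_def endo_trivial_reflexive_digraph_axioms_def)
  show ?thesis using assms(5,6) by (rule polymorphism_essentially_unary)
qed

end
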